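(* Let $S$ be a topological space and let $S_0$ be its $T_0$-reflection. (1) $S$ is weakly scattered if and only if $S_0$ is weakly scattered. (2) $S$ is dispersed if and only if $S_0$ is scattered.
   Context: The $T_0$-reflection $S_0$ of $S$ is the quotient space of $S$ by the equivalence relation $x\sim y$ iff $\overline{\{x\}}=\overline{\{y\}}$; $[x]$ denotes the equivalence class of $x$. For a subspace $T$ of a space $S$: a point $x\in T$ is isolated in $T$ if $\{x\}$ is open in $T$; weakly isolated in $T$ if there is an open $U\subseteq S$ with $x\in T\cap U\subseteq\overline{\{x\}}$ (closure in $S$); detached in $T$ if there is an open $U\subseteq S$ with $x\in U\cap T\subseteq[x]$. $S$ is scattered if each nonempty subspace of $S$ has an isolated point (equivalently, each nonempty closed subspace does). $S$ is weakly scattered if each nonempty closed subspace has a weakly isolated point. $S$ is dispersed if each nonempty closed subset of $S$ has a detached point. *)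

theory Defs
  imports "HOL-Analysis.Abstract_Topological_Spaces"
begin

definition top_indist :: "'a topology \<Rightarrow> ('a \<times> 'a) set" where
  "top_indist S =
     {(x, y). x \<in> topspace S \<and> y \<in> topspace S \<and> S closure_of {x} = S closure_of {y}}"

definition indist_class :: "'a topology \<Rightarrow> 'a \<Rightarrow> 'a set" where
  "indist_class S x = top_indist S `` {x}"

(* The points of the reflection are the equivalence classes; a set of classes is open iff its
   preimage under the projection, which is the union of the set, is open. *)
definition T0_reflection :: "'a topology \<Rightarrow> 'a set topology" where
  "T0_reflection S = topology (\<lambda>V. V \<subseteq> topspace S // top_indist S \<and> openin S (\<Union>V))"

definition isolated_point_in :: "'a topology \<Rightarrow> 'a set \<Rightarrow> 'a \<Rightarrow> bool" where
  "isolated_point_in S T x \<longleftrightarrow> x \<in> T \<and> openin (subtopology S T) {x}"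

definition weakly_isolated_point_in :: "'a topology \<Rightarrow> 'a set \<Rightarrow> 'a \<Rightarrow> bool" where
  "weakly_isolated_point_in S T x \<longleftrightarrow>
     (\<exists>U. openin S U \<and> x \<in> T \<inter> U \<and> T \<inter> U \<subseteq> S closure_of {x})"

definition detached_point_in :: "'a topology \<Rightarrow> 'a set \<Rightarrow> 'a \<Rightarrow> bool" where
  "detached_point_in S T x \<longleftrightarrow>
     (\<exists>U. openin S U \<and> x \<in> U \<inter> T \<and> U \<inter> T \<subseteq> indist_class S x)"

definition scattered_space :: "'a topology \<Rightarrow> bool" where
  "scattered_space S \<longleftrightarrow>
     (\<forall>T. T \<subseteq> topspace S \<and> T \<noteq> {} \<longrightarrow> (\<exists>x. isolated_point_in S T x))"

definition weakly_scattered_space :: "'a topology \<Rightarrow> bool" where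
  "weakly_scattered_space S \<longleftrightarrow>
     (\<forall>T. closedin S T \<and> T \<noteq> {} \<longrightarrow> (\<exists>x. weakly_isolated_point_in S T x))"

definition dispersed_space :: "'a topology \<Rightarrow> bool" where
  "dispersed_space S \<longleftrightarrow>
     (\<forall>T. closedin S T \<and> T \<noteq> {} \<longrightarrow> (\<exists>x. detached_point_in S T x))"

lemma equiv_top_indist: "equiv (topspace S) (top_indist S)"
  by (auto simp: top_indist_def equiv_def refl_on_def sym_def trans_def)

lemma istopology_T0_reflection:
  "istopology (\<lambda>V. V \<subseteq> topspace S // top_indist S \<and> openin S (\<Union>V))"
proof -
  have inter: "\<Union>(V \<inter> W) = \<Union>V \<inter> \<Union>W"
    if "V \<subseteq> topspace S // top_indist S" "W \<subseteq> topspace S // top_indist S" for V W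
    using that quotient_disj[OF equiv_top_indist[of S]] by blast
  have union: "\<Union>(\<Union>K) = (\<Union>V\<in>K. \<Union>V)" for K :: "'a set set set"
    by blast
  show ?thesis
    unfolding istopology_def
    by (auto simp: inter union)
qed

lemma openin_T0_reflection:
  "openin (T0_reflection S) V \<longleftrightarrow> V \<subseteq> topspace S // top_indist S \<and> openin S (\<Union>V)"
  unfolding T0_reflection_def topology_inverse'[OF istopology_T0_reflection] ..

lemma topspace_T0_reflection: "topspace (T0_reflection S) = topspace S // top_indist S"
proof
  show "topspace (T0_reflection S) \<subseteq> topspace S // top_indist S"
    using openin_T0_reflection openin_topspace by blast
  have "openin (T0_reflection S) (topspace S // top_indist S)"
    by (simp add: openin_T0_reflection Union_quotient[OF equiv_top_indist])
  then show "topspace S // top_indist S \<subseteq> topspace (T0_reflection S)"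
    by (rule openin_subset)
qed

lemma quotient_map_indist_class: "quotient_map S (T0_reflection S) (indist_class S)"
proof -
  have img: "indist_class S ` topspace S = topspace S // top_indist S"
    by (auto simp: quotient_def indist_class_def)
  have pre: "{x \<in> topspace S. indist_class S x \<in> V} = \<Union>V"
    if V: "V \<subseteq> topspace S // top_indist S" for V
  proof (intro set_eqI iffI)
    fix x assume "x \<in> {x \<in> topspace S. indist_class S x \<in> V}"
    moreover from this have "x \<in> indist_class S x"
      by (simp add: indist_class_def top_indist_def)
    ultimately show "x \<in> \<Union>V" by blast
  next
    fix x assume "x \<in> \<Union>V"
    then obtain C where C: "C \<in> V" "x \<in> C" by blast
    with V obtain y where "y \<in> topspace S" "C = top_indist S `` {y}"
      by (meson quotientE subsetD)
    with C have "x \<in> topspace S" "C = indist_class S x"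
      by (auto simp: indist_class_def top_indist_def)
    with C show "x \<in> {x \<in> topspace S. indist_class S x \<in> V}" by simp
  qed
  show ?thesis
    unfolding quotient_map_def topspace_T0_reflection
    using img pre by (auto simp: openin_T0_reflection)
qed

end

(* The projection x |-> [x] induces a bijection between the open (closed) sets of S and those of S_0,
   because open sets are saturated. It commutes with intersections with open sets and with
   membership in point closures, so weakly isolated points correspond to weakly isolated points and
   detached points to isolated points. An isolated point of the closure of T already lies in T, so
   scatteredness can be tested on closed sets. *)
theory Submission
  imports Defs
begin

lemma indist_class_eq_iff:
  assumes "x \<in> topspace S" "y \<in> topspace S"
  shows "indist_class S x = indist_class S y \<longleftrightarrow> S closure_of {x} = S closure_of {y}"
  using eq_equiv_class_iff[OF equiv_top_indist assms] assms
  by (simp add: indist_class_def top_indist_def)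

lemma in_indist_class_iff:
  assumes "x \<in> topspace S" "y \<in> topspace S"
  shows "y \<in> indist_class S x \<longleftrightarrow> indist_class S x = indist_class S y"
  unfolding indist_class_eq_iff[OF assms] using assms
  by (simp add: indist_class_def top_indist_def)

text \<open>Saturation of open sets: \<open>x\<close> lies in the closure of \<open>{x}\<close>,
  which equals the closure of \<open>{y}\<close>, so every open neighbourhood of \<open>x\<close>
  contains \<open>y\<close>.\<close>

lemma openin_indist_class_cong:
  assumes "openin S U" "x \<in> U" "y \<in> topspace S" "indist_class S x = indist_class S y"
  shows "y \<in> U"
proof -
  have x: "x \<in> topspace S"
    using assms openin_subset by blast
  then have "x \<in> S closure_of {x}"
    by (auto simp: in_closure_of)
  then have "x \<in> S closure_of {y}"
    using assms(3,4) x indist_class_eq_iff by metis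
  then show "y \<in> U"
    using assms(1,2) by (auto simp: in_closure_of)
qed

lemma indist_class_in_image_openin_iff:
  assumes "openin S U" "x \<in> topspace S"
  shows "indist_class S x \<in> indist_class S ` U \<longleftrightarrow> x \<in> U"
proof
  assume "indist_class S x \<in> indist_class S ` U"
  then obtain u where "u \<in> U" "indist_class S u = indist_class S x"
    by force
  with assms show "x \<in> U"
    by (rule_tac openin_indist_class_cong)
qed simp

text \<open>Images need not commute with intersections. Here saturation of \<open>U\<close> helps:
  if a point of \<open>T\<close> has the same class as a point of \<open>U\<close>, it lies in
  \<open>U\<close> itself.\<close>

lemma image_indist_class_Int_openin:
  assumes "T \<subseteq> topspace S" "openin S U"
  shows "indist_class S ` T \<inter> indist_class S ` U = indist_class S ` (T \<inter> U)"
proof -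
  have "x \<in> U" if "x \<in> T" "indist_class S x \<in> indist_class S ` U" for x
    using that assms indist_class_in_image_openin_iff[of S U x] by blast
  then show ?thesis
    by auto
qed

lemma topspace_T0_reflection_eq_image:
  "topspace (T0_reflection S) = indist_class S ` topspace S"
  using quotient_imp_surjective_map[OF quotient_map_indist_class] by metis

text \<open>An open \<open>V\<close> is the image of its preimage because the projection is onto.
  Conversely, saturation makes \<open>U\<close> the full preimage of its image, and a quotient map
  detects openness on preimages.\<close>

lemma openin_T0_reflection_iff_image:
  "openin (T0_reflection S) V \<longleftrightarrow> (\<exists>U. openin S U \<and> V = indist_class S ` U)"
proof
  assume V: "openin (T0_reflection S) V"
  have "openin S {x \<in> topspace S. indist_class S x \<in> V}"
    using quotient_imp_continuous_map[OF quotient_map_indist_class] V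
    by (rule openin_continuous_map_preimage)
  moreover have "V = indist_class S ` {x \<in> topspace S. indist_class S x \<in> V}"
    using openin_subset[OF V] by (auto simp: topspace_T0_reflection_eq_image)
  ultimately show "\<exists>U. openin S U \<and> V = indist_class S ` U"
    by (intro exI conjI)
next
  assume "\<exists>U. openin S U \<and> V = indist_class S ` U"
  then obtain U where U: "openin S U" and V: "V = indist_class S ` U"
    by (elim exE conjE)
  have "{x \<in> topspace S. indist_class S x \<in> V} = U"
    unfolding V using openin_subset[OF U]
    by (auto simp: indist_class_in_image_openin_iff[OF U] cong: conj_cong)
  moreover have "V \<subseteq> topspace (T0_reflection S)"
    unfolding V topspace_T0_reflection_eq_image using openin_subset[OF U] by (rule image_mono)
  ultimately show "openin (T0_reflection S) V"
    using U quotient_map_indist_class[of S] unfolding quotient_map_def by auto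
qed

text \<open>As a rewrite rule, this replaces an open witness in the reflection by the image of an
  open set of \<open>S\<close>.\<close>

lemma ex_openin_T0_reflection_iff:
  "(\<exists>V. openin (T0_reflection S) V \<and> P V) \<longleftrightarrow> (\<exists>U. openin S U \<and> P (indist_class S ` U))"
  by (auto simp: openin_T0_reflection_iff_image)

text \<open>No class has members both inside and outside the saturated set \<open>U\<close>, so
  complements survive the projection. This carries the correspondence over to closed sets.\<close>

lemma image_indist_class_Diff_openin:
  assumes "openin S U"
  shows "indist_class S ` (topspace S - U) = topspace (T0_reflection S) - indist_class S ` U"
  using indist_class_in_image_openin_iff[OF assms]
  unfolding topspace_T0_reflection_eq_image by auto

lemma closedin_T0_reflection_iff_image:
  "closedin (T0_reflection S) C \<longleftrightarrow> (\<exists>T. closedin S T \<and> C = indist_class S ` T)"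
proof
  assume C: "closedin (T0_reflection S) C"
  then have "openin (T0_reflection S) (topspace (T0_reflection S) - C)"
    by (simp add: closedin_def)
  then obtain U where U: "openin S U" "topspace (T0_reflection S) - C = indist_class S ` U"
    unfolding openin_T0_reflection_iff_image by (elim exE conjE)
  have "C = topspace (T0_reflection S) - (topspace (T0_reflection S) - C)"
    using closedin_subset[OF C] by (simp add: double_diff)
  also have "\<dots> = indist_class S ` (topspace S - U)"
    unfolding U(2) image_indist_class_Diff_openin[OF U(1)] ..
  finally show "\<exists>T. closedin S T \<and> C = indist_class S ` T"
    using U(1) by (intro exI[of _ "topspace S - U"]) auto
next
  assume "\<exists>T. closedin S T \<and> C = indist_class S ` T"
  then obtain T where T: "closedin S T" "C = indist_class S ` T"
    by (elim exE conjE)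
  have U: "openin S (topspace S - T)"
    using T(1) by blast
  have "topspace S - (topspace S - T) = T"
    using closedin_subset[OF T(1)] by (simp add: double_diff)
  then have "C = topspace (T0_reflection S) - indist_class S ` (topspace S - T)"
    using T(2) image_indist_class_Diff_openin[OF U] by simp
  moreover have "openin (T0_reflection S) (indist_class S ` (topspace S - T))"
    unfolding openin_T0_reflection_iff_image using U by blast
  ultimately show "closedin (T0_reflection S) C"
    by (simp add: closedin_diff)
qed

lemma all_closedin_T0_reflection_iff:
  "(\<forall>C. closedin (T0_reflection S) C \<and> C \<noteq> {} \<longrightarrow> P C) \<longleftrightarrow>
     (\<forall>T. closedin S T \<and> T \<noteq> {} \<longrightarrow> P (indist_class S ` T))"
  by (auto simp: closedin_T0_reflection_iff_image)

text \<open>The negated existential exposes the separating open set in the shape that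
  \<open>ex_openin_T0_reflection_iff\<close> rewrites.\<close>

lemma in_closure_of_singleton_iff:
  assumes "x \<in> topspace X"
  shows "x \<in> X closure_of {y} \<longleftrightarrow> \<not> (\<exists>U. openin X U \<and> x \<in> U \<and> y \<notin> U)"
  using assms by (auto simp: in_closure_of)

text \<open>An open \<open>U\<close> separates \<open>x\<close> from \<open>y\<close> exactly when
  its image separates their classes.\<close>

lemma indist_class_in_closure_of_iff:
  assumes "x \<in> topspace S" "y \<in> topspace S"
  shows "indist_class S x \<in> T0_reflection S closure_of {indist_class S y}
     \<longleftrightarrow> x \<in> S closure_of {y}"
proof -
  have "indist_class S x \<in> topspace (T0_reflection S)"
    using assms by (simp add: topspace_T0_reflection_eq_image)
  then show ?thesis
    using assms
    by (simp add: in_closure_of_singleton_iff ex_openin_T0_reflection_iff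
        indist_class_in_image_openin_iff cong: conj_cong)
qed

lemma weakly_isolated_point_in_T0_reflection_iff:
  assumes T: "T \<subseteq> topspace S" "x \<in> T"
  shows "weakly_isolated_point_in (T0_reflection S) (indist_class S ` T) (indist_class S x)
     \<longleftrightarrow> weakly_isolated_point_in S T x"
proof -
  let ?p = "indist_class S"
  \<comment> \<open>The witnesses on both sides correspond: the conditions on \<open>U\<close> and
    on its image are compared for each fixed open \<open>U\<close>.\<close>
  have "?p x \<in> ?p ` T \<inter> ?p ` U \<and> ?p ` T \<inter> ?p ` U \<subseteq> T0_reflection S closure_of {?p x}
      \<longleftrightarrow> x \<in> T \<inter> U \<and> T \<inter> U \<subseteq> S closure_of {x}" if U: "openin S U" for U
  proof -
    have "?p x \<in> ?p ` T \<inter> ?p ` U \<longleftrightarrow> x \<in> T \<inter> U"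
      using T indist_class_in_image_openin_iff[OF U, of x] by auto
    moreover have "?p y \<in> T0_reflection S closure_of {?p x} \<longleftrightarrow> y \<in> S closure_of {x}"
      if "y \<in> T \<inter> U" for y
      using that T by (intro indist_class_in_closure_of_iff) auto
    then have "?p ` T \<inter> ?p ` U \<subseteq> T0_reflection S closure_of {?p x}
        \<longleftrightarrow> T \<inter> U \<subseteq> S closure_of {x}"
      unfolding image_indist_class_Int_openin[OF T(1) U] image_subset_iff subset_eq by simp
    ultimately show ?thesis
      by simp
  qed
  then show ?thesis
    unfolding weakly_isolated_point_in_def ex_openin_T0_reflection_iff by (simp cong: conj_cong)
qed

lemma isolated_point_in_iff:
  "isolated_point_in S T x \<longleftrightarrow> (\<exists>U. openin S U \<and> T \<inter> U = {x})"
  by (auto simp: isolated_point_in_def openin_subtopology)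

lemma isolated_point_in_T0_reflection_iff:
  assumes T: "T \<subseteq> topspace S" "x \<in> T"
  shows "isolated_point_in (T0_reflection S) (indist_class S ` T) (indist_class S x)
     \<longleftrightarrow> detached_point_in S T x"
proof -
  let ?p = "indist_class S"
  \<comment> \<open>On the left \<open>?p x\<close> is a point of the reflection, on the right a set
    of points of \<open>S\<close>: the fibre of the projection over that point.\<close>
  have "?p ` T \<inter> ?p ` U = {?p x} \<longleftrightarrow> x \<in> U \<inter> T \<and> U \<inter> T \<subseteq> ?p x"
    if U: "openin S U" for U
  proof -
    have "?p ` T \<inter> ?p ` U = {?p x}
        \<longleftrightarrow> ?p x \<in> ?p ` T \<inter> ?p ` U \<and> ?p ` T \<inter> ?p ` U \<subseteq> {?p x}"
      by auto
    moreover have "?p x \<in> ?p ` T \<inter> ?p ` U \<longleftrightarrow> x \<in> U \<inter> T"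
      using T indist_class_in_image_openin_iff[OF U, of x] by auto
    moreover have "?p y = ?p x \<longleftrightarrow> y \<in> ?p x" if "y \<in> T \<inter> U" for y
      using that T in_indist_class_iff[of x S y] by auto
    then have "?p ` T \<inter> ?p ` U \<subseteq> {?p x} \<longleftrightarrow> U \<inter> T \<subseteq> ?p x"
      unfolding image_indist_class_Int_openin[OF T(1) U] image_subset_iff subset_eq by auto
    ultimately show ?thesis
      by argo
  qed
  then show ?thesis
    unfolding isolated_point_in_iff detached_point_in_def ex_openin_T0_reflection_iff
    by (simp cong: conj_cong)
qed

text \<open>An open set that meets the closure of \<open>T\<close> meets \<open>T\<close>. If it
  meets the closure only in \<open>x\<close>, then \<open>x\<close> must belong to
  \<open>T\<close>.\<close>

lemma isolated_point_in_closure_of: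
  assumes "T \<subseteq> topspace S" "isolated_point_in S (S closure_of T) x"
  shows "isolated_point_in S T x"
proof -
  obtain U where U: "openin S U" "S closure_of T \<inter> U = {x}"
    using assms(2) by (auto simp: isolated_point_in_iff)
  then have "T \<inter> U \<noteq> {}"
    using openin_Int_closure_of_eq_empty[OF U(1), of T] by blast
  with U(2) closure_of_subset[OF assms(1)] have "T \<inter> U = {x}"
    by auto
  with U(1) show ?thesis
    by (auto simp: isolated_point_in_iff)
qed

lemma scattered_space_iff_closedin:
  "scattered_space S \<longleftrightarrow>
     (\<forall>T. closedin S T \<and> T \<noteq> {} \<longrightarrow> (\<exists>x. isolated_point_in S T x))"
proof
  assume "scattered_space S"
  then show "\<forall>T. closedin S T \<and> T \<noteq> {} \<longrightarrow> (\<exists>x. isolated_point_in S T x)"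
    unfolding scattered_space_def using closedin_subset by blast
next
  assume closed: "\<forall>T. closedin S T \<and> T \<noteq> {} \<longrightarrow> (\<exists>x. isolated_point_in S T x)"
  show "scattered_space S"
    unfolding scattered_space_def
  proof (intro allI impI, elim conjE)
    fix T assume T: "T \<subseteq> topspace S" "T \<noteq> {}"
    then have "S closure_of T \<noteq> {}"
      using closure_of_subset by blast
    with closed obtain x where "isolated_point_in S (S closure_of T) x"
      using closedin_closure_of by blast
    with T(1) have "isolated_point_in S T x"
      by (rule isolated_point_in_closure_of)
    then show "\<exists>x. isolated_point_in S T x" ..
  qed
qed

theorem proposition7p10:
  fixes S :: "'a topology"
  shows "(weakly_scattered_space S \<longleftrightarrow> weakly_scattered_space (T0_reflection S)) \<and>
         (dispersed_space S \<longleftrightarrow> scattered_space (T0_reflection S))"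
proof
  let ?p = "indist_class S"
  have "(\<exists>c. weakly_isolated_point_in (T0_reflection S) (?p ` T) c)
      \<longleftrightarrow> (\<exists>x. weakly_isolated_point_in S T x)" if "closedin S T" for T
  proof -
    \<comment> \<open>A weakly isolated point belongs to the subspace by definition, so any such
      \<open>c\<close> has the form \<open>?p x\<close> with \<open>x\<close> in
      \<open>T\<close>.\<close>
    have "(\<exists>c. weakly_isolated_point_in (T0_reflection S) (?p ` T) c)
        \<longleftrightarrow> (\<exists>x\<in>T. weakly_isolated_point_in (T0_reflection S) (?p ` T) (?p x))"
      unfolding weakly_isolated_point_in_def by auto
    also have "\<dots> \<longleftrightarrow> (\<exists>x\<in>T. weakly_isolated_point_in S T x)"
      using weakly_isolated_point_in_T0_reflection_iff[OF closedin_subset[OF that]] by simp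
    also have "\<dots> \<longleftrightarrow> (\<exists>x. weakly_isolated_point_in S T x)"
      unfolding weakly_isolated_point_in_def by auto
    finally show ?thesis .
  qed
  then show "weakly_scattered_space S \<longleftrightarrow> weakly_scattered_space (T0_reflection S)"
    unfolding weakly_scattered_space_def all_closedin_T0_reflection_iff by simp
  have "(\<exists>c. isolated_point_in (T0_reflection S) (?p ` T) c)
      \<longleftrightarrow> (\<exists>x. detached_point_in S T x)" if "closedin S T" for T
  proof -
    have "(\<exists>c. isolated_point_in (T0_reflection S) (?p ` T) c)
        \<longleftrightarrow> (\<exists>x\<in>T. isolated_point_in (T0_reflection S) (?p ` T) (?p x))"
      unfolding isolated_point_in_def by auto
    also have "\<dots> \<longleftrightarrow> (\<exists>x\<in>T. detached_point_in S T x)"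
      using isolated_point_in_T0_reflection_iff[OF closedin_subset[OF that]] by simp
    also have "\<dots> \<longleftrightarrow> (\<exists>x. detached_point_in S T x)"
      unfolding detached_point_in_def by auto
    finally show ?thesis .
  qed
  then show "dispersed_space S \<longleftrightarrow> scattered_space (T0_reflection S)"
    \<comment> \<open>Scatteredness is first reduced to closed sets, since those of the reflection
      are exactly the images of closed sets of \<open>S\<close>.\<close>
    unfolding dispersed_space_def scattered_space_iff_closedin all_closedin_T0_reflection_iff
    by simp
qed

end
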